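(* Let $0<\alpha<1$ and let $m_0:[0,\infty)\to\mathbb R$ be given. Let $m$ and $M$ be bounded and uniformly continuous functions on $[0,+\infty)^2$ that are, respectively, a viscosity subsolution and a viscosity supersolution of $$\begin{cases}m_t+(m_\rho)_+^\alpha\,m=0,&t>0,\ \rho>0,\\ m(0,\rho)=m_0(\rho),\\ m(t,0)=0.\end{cases}$$ Then $m\le M$ on $[0,+\infty)^2$.
   Context: $s_+=\max(s,0)$. For a continuous function $f$ on $[0,\infty)^2$ and an interior point $X=(t,\rho)\in(0,\infty)^2$, the Fréchet sub- and superdifferentials are $D^-f(X)=\{p\in\mathbb R^2:\liminf_{Y\to X}\frac{f(Y)-f(X)-p\cdot(Y-X)}{|Y-X|}\ge0\}$ and $D^+f(X)=\{p\in\mathbb R^2:\limsup_{Y\to X}\frac{f(Y)-f(X)-p\cdot(Y-X)}{|Y-X|}\le0\}$. A function $m\in\mathcal C([0,+\infty)^2)$ is a viscosity subsolution of the problem if $p_1+(p_2)_+^\alpha m(t,\rho)\le0$ for all $(t,\rho)\in(0,\infty)^2$ and all $(p_1,p_2)\in D^+m(t,\rho)$, and $m(0,\rho)\le m_0(\rho)$, $m(t,0)\le0$. It is a viscosity supersolution if $p_1+(p_2)_+^\alpha m(t,\rho)\ge0$ for all $(t,\rho)\in(0,\infty)^2$ and all $(p_1,p_2)\in D^-m(t,\rho)$, and $m(0,\rho)\ge m_0(\rho)$, $m(t,0)\ge0$. *)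

theory Defs
  imports "HOL-Analysis.Analysis"
begin

text \<open>Points of the plane are pairs \<open>(t, \<rho>)\<close>; the norm on \<^typ>\<open>real \<times> real\<close> is the
  Euclidean one. Functions on the closed quadrant are total functions of which only the values
  on the quadrant matter.\<close>

definition quadrant :: "(real \<times> real) set" where
  "quadrant = {0..} \<times> {0..}"

text \<open>The limits inferior and superior are taken in the extended reals, so they always exist.\<close>

definition frechet_subdiff :: "(real \<times> real \<Rightarrow> real) \<Rightarrow> real \<times> real \<Rightarrow> (real \<times> real) set" where
  "frechet_subdiff f X =
    {p. Liminf (at X within quadrant)
          (\<lambda>Y. ereal ((f Y - f X - p \<bullet> (Y - X)) / norm (Y - X))) \<ge> 0}"

definition frechet_superdiff :: "(real \<times> real \<Rightarrow> real) \<Rightarrow> real \<times> real \<Rightarrow> (real \<times> real) set" where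
  "frechet_superdiff f X =
    {p. Limsup (at X within quadrant)
          (\<lambda>Y. ereal ((f Y - f X - p \<bullet> (Y - X)) / norm (Y - X))) \<le> 0}"

definition viscosity_subsolution ::
    "real \<Rightarrow> (real \<Rightarrow> real) \<Rightarrow> (real \<times> real \<Rightarrow> real) \<Rightarrow> bool" where
  "viscosity_subsolution \<alpha> m0 m \<longleftrightarrow>
    continuous_on quadrant m \<and>
    (\<forall>t>0. \<forall>\<rho>>0. \<forall>(p1, p2) \<in> frechet_superdiff m (t, \<rho>).
        p1 + (max p2 0 powr \<alpha>) * m (t, \<rho>) \<le> 0) \<and>
    (\<forall>\<rho>\<ge>0. m (0, \<rho>) \<le> m0 \<rho>) \<and>
    (\<forall>t\<ge>0. m (t, 0) \<le> 0)"

definition viscosity_supersolution ::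
    "real \<Rightarrow> (real \<Rightarrow> real) \<Rightarrow> (real \<times> real \<Rightarrow> real) \<Rightarrow> bool" where
  "viscosity_supersolution \<alpha> m0 M \<longleftrightarrow>
    continuous_on quadrant M \<and>
    (\<forall>t>0. \<forall>\<rho>>0. \<forall>(p1, p2) \<in> frechet_subdiff M (t, \<rho>).
        p1 + (max p2 0 powr \<alpha>) * M (t, \<rho>) \<ge> 0) \<and>
    (\<forall>\<rho>\<ge>0. M (0, \<rho>) \<ge> m0 \<rho>) \<and>
    (\<forall>t\<ge>0. M (t, 0) \<ge> 0)"

end

theory Submission
  imports Defs
begin

text \<open>Doubling of variables. If \<open>m - M\<close> is at least \<open>\<sigma> > 0\<close> at \<open>X0\<close>, maximise
  \<open>m X - M Y - k |X - Y|\<^sup>2 - \<nu> (|X|\<^sup>2 + |Y|\<^sup>2) - l (t + s)\<close> for \<open>X = (t, \<rho>)\<close>,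
  \<open>Y = (s, \<xi>)\<close>. For \<open>k\<close> large, uniform continuity and the boundary conditions keep
  both points off the boundary, so both viscosity inequalities apply at the maximum. Subtracting
  them leaves \<open>2 l \<le> (2 \<nu> (\<rho> + \<xi>))\<^sup>\<alpha> sup |m|\<close>: the Hamiltonian
  is nondecreasing in the unknown and \<open>\<alpha>\<close>-Hoelder in the gradient. Since
  \<open>\<nu> \<rho>\<close> and \<open>\<nu> \<xi>\<close> are \<open>O(\<surd>\<nu>)\<close>, this fails for small \<open>\<nu>\<close>.\<close>

text \<open>The fractions \<open>x / (x + y)\<close> and \<open>y / (x + y)\<close> lie in [0, 1],
  where \<open>u \<le> u powr a\<close>, and they sum to 1; rescaling by
  \<open>(x + y) powr a\<close> gives subadditivity.\<close>

lemma powr_add_le_add_powr: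
  fixes x y a :: real
  assumes "0 \<le> x" "0 \<le> y" "0 < a" "a \<le> 1"
  shows "(x + y) powr a \<le> x powr a + y powr a"
proof (cases "x + y = 0")
  case True
  then show ?thesis using assms by simp
next
  case False
  then have pos: "x + y > 0" using assms by simp
  have le: "u \<le> u powr a" if "0 \<le> u" "u \<le> 1" for u :: real
  proof (cases "u = 0")
    case False
    then show ?thesis using powr_mono'[of a 1 u] that assms by simp
  qed simp
  have "1 = x / (x + y) + y / (x + y)"
    using pos by (simp add: add_divide_distrib[symmetric])
  also have "\<dots> \<le> (x / (x + y)) powr a + (y / (x + y)) powr a"
    using pos assms by (intro add_mono le) auto
  also have "\<dots> = (x powr a + y powr a) / (x + y) powr a"
    using pos assms by (simp add: powr_divide add_divide_distrib)
  finally show ?thesis using pos by (simp add: le_divide_eq)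
qed

text \<open>One-sided Hoelder bound with constant 1: the positive part is 1-Lipschitz and the power
  is subadditive.\<close>

lemma positive_part_powr_diff_le:
  fixes p q a :: real
  assumes "q \<le> p" "0 < a" "a \<le> 1"
  shows "max p 0 powr a - max q 0 powr a \<le> (p - q) powr a"
proof -
  have "max p 0 powr a \<le> (max q 0 + (p - q)) powr a"
    using assms by (intro powr_mono2) auto
  also have "\<dots> \<le> max q 0 powr a + (p - q) powr a"
    using assms by (intro powr_add_le_add_powr) auto
  finally show ?thesis by simp
qed

text \<open>Replaces compactness of the domain: the superlevel set through \<open>x0\<close> is
  closed, and the decay makes it bounded.\<close>

lemma continuous_attains_max_of_quadratic_decay:
  fixes f :: "'a::euclidean_space \<Rightarrow> real"
  assumes "closed S" "x0 \<in> S" "continuous_on S f" "0 < \<nu>"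
    and decay: "\<And>x. x \<in> S \<Longrightarrow> f x \<le> C - \<nu> * (norm x)\<^sup>2"
  obtains x where "x \<in> S" "\<And>y. y \<in> S \<Longrightarrow> f y \<le> f x"
proof -
  define T where "T = {x \<in> S. f x0 \<le> f x}"
  have T: "T = S \<inter> f -` {f x0..}" by (auto simp: T_def)
  have "closed T"
    unfolding T using assms by (intro continuous_closed_preimage) auto
  moreover have "bounded T"
    unfolding bounded_iff
  proof (intro exI ballI)
    fix x assume "x \<in> T"
    then have "f x0 \<le> C - \<nu> * (norm x)\<^sup>2" using decay by (fastforce simp: T_def)
    then have "(norm x)\<^sup>2 \<le> (C - f x0) / \<nu>" using \<open>0 < \<nu>\<close> by (simp add: field_simps)
    then show "norm x \<le> sqrt ((C - f x0) / \<nu>)" by (rule real_le_rsqrt)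
  qed
  ultimately have "compact T" by (simp add: compact_eq_bounded_closed)
  moreover have "x0 \<in> T" "continuous_on T f"
    using assms by (auto simp: T_def intro: continuous_on_subset)
  ultimately obtain x where "x \<in> T" "\<forall>y\<in>T. f y \<le> f x"
    using continuous_attains_sup[of T f] by blast
  then have "f y \<le> f x" if "y \<in> S" for y
    using that by (force simp: T_def)
  with that \<open>x \<in> T\<close> show thesis by (auto simp: T_def)
qed

text \<open>The difference quotient is at most \<open>C * norm (Y - X)\<close>, which tends to
  0.\<close>

lemma superdiff_of_quadratic_bound:
  assumes "\<And>Y. Y \<in> quadrant \<Longrightarrow> f Y - f X - p \<bullet> (Y - X) \<le> C * (norm (Y - X))\<^sup>2"
  shows "p \<in> frechet_superdiff f X"
proof -
  let ?q = "\<lambda>Y. (f Y - f X - p \<bullet> (Y - X)) / norm (Y - X)"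
  have "\<forall>\<^sub>F Y in at X within quadrant. ereal (?q Y) < y" if "0 < y" for y
  proof -
    have "((\<lambda>Y. ereal (C * norm (Y - X))) \<longlongrightarrow> ereal (C * norm (X - X))) (at X within quadrant)"
      by (intro tendsto_intros)
    then have "\<forall>\<^sub>F Y in at X within quadrant. ereal (C * norm (Y - X)) < y"
      using that by (intro order_tendstoD(2)) (auto simp: zero_ereal_def)
    moreover have "\<forall>\<^sub>F Y in at X within quadrant. Y \<in> quadrant \<and> Y \<noteq> X"
      by (auto simp: eventually_at_filter)
    ultimately show ?thesis
    proof eventually_elim
      case (elim Y)
      then have "?q Y \<le> C * norm (Y - X)"
        using assms[of Y] by (simp add: divide_le_eq power2_eq_square mult.assoc)
      then show ?case using elim(1) le_less_trans by (metis ereal_less_eq(3))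
    qed
  qed
  then show ?thesis by (simp add: frechet_superdiff_def Limsup_le_iff)
qed

text \<open>Reduces to the superdifferential of \<open>- f\<close> at \<open>- p\<close>, since
  negation exchanges Limsup and Liminf.\<close>

lemma subdiff_of_quadratic_bound:
  assumes "\<And>Y. Y \<in> quadrant \<Longrightarrow> f Y - f X - p \<bullet> (Y - X) \<ge> - (C * (norm (Y - X))\<^sup>2)"
  shows "p \<in> frechet_subdiff f X"
proof -
  let ?q = "\<lambda>Y. ereal ((f Y - f X - p \<bullet> (Y - X)) / norm (Y - X))"
  have "- p \<in> frechet_superdiff (\<lambda>Y. - f Y) X"
    using assms by (intro superdiff_of_quadratic_bound[where C = C]) force
  moreover have "ereal ((- f Y - - f X - - p \<bullet> (Y - X)) / norm (Y - X)) = - ?q Y" for Y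
    by (simp add: minus_divide_left)
  ultimately have "Limsup (at X within quadrant) (\<lambda>Y. - ?q Y) \<le> 0"
    by (simp only: frechet_superdiff_def mem_Collect_eq)
  then show ?thesis
    unfolding ereal_Limsup_uminus frechet_subdiff_def by simp
qed

text \<open>Exact Taylor expansion of a penalty about \<open>X\<close>: gradient
  \<open>2 * c * (X - Y)\<close> and a purely quadratic remainder. Taking \<open>Y\<close> to be 0
  covers the penalty at infinity.\<close>

lemma scaled_norm_diff_sq_expand:
  fixes X Y Z :: "'a::real_inner"
  shows "c * (norm (Z - Y))\<^sup>2 =
    c * (norm (X - Y))\<^sup>2 + 2 * c * ((X - Y) \<bullet> (Z - X)) + c * (norm (Z - X))\<^sup>2"
  unfolding power2_norm_eq_inner by (simp add: inner_commute algebra_simps)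

lemma closed_quadrant: "closed quadrant"
  unfolding quadrant_def by (intro closed_Times) auto

lemma sub_le_super_on_boundary:
  assumes "viscosity_subsolution \<alpha> m0 m" "viscosity_supersolution \<alpha> m0 M"
    and "X \<in> quadrant" "fst X = 0 \<or> snd X = 0"
  shows "m X \<le> M X"
proof -
  obtain t \<rho> where X: "X = (t, \<rho>)" "0 \<le> t" "0 \<le> \<rho>"
    using assms(3) by (auto simp: quadrant_def)
  have "m (0, \<rho>) \<le> m0 \<rho>" "m0 \<rho> \<le> M (0, \<rho>)" "m (t, 0) \<le> 0" "0 \<le> M (t, 0)"
    using assms(1,2) X unfolding viscosity_subsolution_def viscosity_supersolution_def by blast+
  then have "m (0, \<rho>) \<le> M (0, \<rho>)" "m (t, 0) \<le> M (t, 0)" by linarith+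
  then show ?thesis using assms(4) X by auto
qed

lemma viscosity_subsolutionD:
  assumes "viscosity_subsolution \<alpha> m0 m" "0 < fst X" "0 < snd X" "p \<in> frechet_superdiff m X"
  shows "fst p + max (snd p) 0 powr \<alpha> * m X \<le> 0"
proof -
  have "\<forall>(p1, p2) \<in> frechet_superdiff m (fst X, snd X).
      p1 + max p2 0 powr \<alpha> * m (fst X, snd X) \<le> 0"
    using assms(1-3) unfolding viscosity_subsolution_def by blast
  from bspec[OF this, of p] assms(4) show ?thesis by (simp add: case_prod_unfold)
qed

lemma viscosity_supersolutionD:
  assumes "viscosity_supersolution \<alpha> m0 M" "0 < fst X" "0 < snd X" "p \<in> frechet_subdiff M X"
  shows "0 \<le> fst p + max (snd p) 0 powr \<alpha> * M X"
proof -
  have "\<forall>(p1, p2) \<in> frechet_subdiff M (fst X, snd X).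
      0 \<le> p1 + max p2 0 powr \<alpha> * M (fst X, snd X)"
    using assms(1-3) unfolding viscosity_supersolution_def by blast
  from bspec[OF this, of p] assms(4) show ?thesis by (simp add: case_prod_unfold)
qed

text \<open>With \<open>Y\<close> frozen, maximality bounds the increments of \<open>f\<close> by
  those of the penalties; the vector is the gradient of the penalties at \<open>X\<close>, and their
  remainders add up to the constant \<open>k + \<nu>\<close>.\<close>

lemma doubled_max_superdiff:
  fixes e :: "real \<times> real"
  assumes "\<And>Z. Z \<in> quadrant \<Longrightarrow>
      f Z - k * (norm (Z - Y))\<^sup>2 - \<nu> * (norm Z)\<^sup>2 - e \<bullet> Z
      \<le> f X - k * (norm (X - Y))\<^sup>2 - \<nu> * (norm X)\<^sup>2 - e \<bullet> X"
  shows "(2 * k) *\<^sub>R (X - Y) + (2 * \<nu>) *\<^sub>R X + e \<in> frechet_superdiff f X"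
proof (rule superdiff_of_quadratic_bound[where C = "k + \<nu>"])
  fix Z assume Z: "Z \<in> quadrant"
  show "f Z - f X - ((2 * k) *\<^sub>R (X - Y) + (2 * \<nu>) *\<^sub>R X + e) \<bullet> (Z - X)
      \<le> (k + \<nu>) * (norm (Z - X))\<^sup>2"
    using assms[OF Z] scaled_norm_diff_sq_expand[of k Z Y X] scaled_norm_diff_sq_expand[of \<nu> Z 0 X]
    by (simp add: inner_add_left inner_diff_right[of e] distrib_right)
qed

text \<open>Here \<open>f\<close> enters with a minus sign, so the gradient in the second variable
  is negated: the coupling term is again \<open>(2 * k) *\<^sub>R (X - Y)\<close>, while the other
  two change sign.\<close>

lemma doubled_max_subdiff:
  fixes e :: "real \<times> real"
  assumes "\<And>Z. Z \<in> quadrant \<Longrightarrow>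
      - f Z - k * (norm (X - Z))\<^sup>2 - \<nu> * (norm Z)\<^sup>2 - e \<bullet> Z
      \<le> - f Y - k * (norm (X - Y))\<^sup>2 - \<nu> * (norm Y)\<^sup>2 - e \<bullet> Y"
  shows "(2 * k) *\<^sub>R (X - Y) - (2 * \<nu>) *\<^sub>R Y - e \<in> frechet_subdiff f Y"
proof (rule subdiff_of_quadratic_bound[where C = "k + \<nu>"])
  fix Z assume Z: "Z \<in> quadrant"
  show "f Z - f Y - ((2 * k) *\<^sub>R (X - Y) - (2 * \<nu>) *\<^sub>R Y - e) \<bullet> (Z - Y)
      \<ge> - ((k + \<nu>) * (norm (Z - Y))\<^sup>2)"
    using assms[OF Z] scaled_norm_diff_sq_expand[of k Z X Y] scaled_norm_diff_sq_expand[of \<nu> Z 0 Y]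
    by (simp add: inner_diff_left[of _ _ "Z - Y"] inner_diff_right[of e] distrib_right
        right_diff_distrib norm_minus_commute)
qed

text \<open>With a, b the two powers, a u - b v = (a - b) u + b (u - v). The last term is
  nonnegative by monotonicity in the unknown, and the first is at least
  \<open>- (p2 - q2) powr \<alpha> * B\<close>, too small to absorb \<open>2 * l\<close>.\<close>

lemma viscosity_inequalities_incompatible:
  fixes u v p1 p2 q1 q2 :: real
  assumes sub: "p1 + max p2 0 powr \<alpha> * u \<le> 0" and super: "0 \<le> q1 + max q2 0 powr \<alpha> * v"
    and "0 < \<alpha>" "\<alpha> \<le> 1" "v \<le> u" "\<bar>u\<bar> \<le> B"
    and "2 * l \<le> p1 - q1" "q2 \<le> p2" "(p2 - q2) powr \<alpha> * B < 2 * l"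
  shows False
proof -
  let ?a = "max p2 0 powr \<alpha>" and ?b = "max q2 0 powr \<alpha>"
  have "0 \<le> ?b * (u - v)" using assms by simp
  have "(?a - ?b) * (- u) \<le> (p2 - q2) powr \<alpha> * B"
  proof -
    have "0 \<le> ?a - ?b" using assms by (simp add: powr_mono2)
    then have "(?a - ?b) * (- u) \<le> (?a - ?b) * B" using assms by (intro mult_left_mono) auto
    also have "\<dots> \<le> (p2 - q2) powr \<alpha> * B"
      using assms positive_part_powr_diff_le by (intro mult_right_mono) auto
    finally show ?thesis .
  qed
  then show False using \<open>0 \<le> ?b * (u - v)\<close> assms by (simp add: algebra_simps)
qed
theorem theorem7p5:
  fixes \<alpha> :: real and m0 :: "real \<Rightarrow> real" and m M :: "real \<times> real \<Rightarrow> real"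
  assumes "0 < \<alpha>" and "\<alpha> < 1"
    and "bounded (m ` quadrant)" and "uniformly_continuous_on quadrant m"
    and "bounded (M ` quadrant)" and "uniformly_continuous_on quadrant M"
    and "viscosity_subsolution \<alpha> m0 m"
    and "viscosity_supersolution \<alpha> m0 M"
  shows "\<forall>X \<in> quadrant. m X \<le> M X"
proof (intro ballI, rule ccontr)
  fix X0 assume X0: "X0 \<in> quadrant" and "\<not> m X0 \<le> M X0"
  define \<sigma> where "\<sigma> = m X0 - M X0"
  have "0 < \<sigma>" using \<open>\<not> m X0 \<le> M X0\<close> by (simp add: \<sigma>_def)

  obtain B where "B > 0"
    and Bm: "\<And>X. X \<in> quadrant \<Longrightarrow> \<bar>m X\<bar> \<le> B" and BM: "\<And>X. X \<in> quadrant \<Longrightarrow> \<bar>M X\<bar> \<le> B"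
    using bounded_Un[of "m ` quadrant" "M ` quadrant"] assms(3,5) unfolding bounded_pos by auto

  \<comment> \<open>The tolerance \<open>\<sigma> / 2\<close> is the gap between \<open>m\<close>
    and \<open>M\<close> that survives at the maximum.\<close>
  obtain d1 where "d1 > 0" and
    d1: "\<And>X Y. \<lbrakk>X \<in> quadrant; Y \<in> quadrant; dist X Y < d1\<rbrakk> \<Longrightarrow> dist (m X) (m Y) < \<sigma> / 2"
    using assms(4) \<open>0 < \<sigma>\<close> unfolding uniformly_continuous_on_def
    by (metis half_gt_zero)
  obtain d2 where "d2 > 0" and
    d2: "\<And>X Y. \<lbrakk>X \<in> quadrant; Y \<in> quadrant; dist X Y < d2\<rbrakk> \<Longrightarrow> dist (M X) (M Y) < \<sigma> / 2"
    using assms(6) \<open>0 < \<sigma>\<close> unfolding uniformly_continuous_on_def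
    by (metis half_gt_zero)
  define \<delta> where "\<delta> = min d1 d2"
  have "\<delta> > 0" using \<open>d1 > 0\<close> \<open>d2 > 0\<close> by (simp add: \<delta>_def)

  \<comment> \<open>The two time penalties at \<open>(X0, X0)\<close> then cost at most
    \<open>\<sigma> / 4\<close>; the added 1 covers \<open>fst X0 = 0\<close>.\<close>
  define l where "l = \<sigma> / (8 * (fst X0 + 1))"
  have "fst X0 \<ge> 0" using X0 by (auto simp: quadrant_def)
  then have "l > 0" and l_small: "2 * (l * fst X0) \<le> \<sigma> / 4"
    using \<open>0 < \<sigma>\<close> by (auto simp: l_def field_simps)
  \<comment> \<open>The gradient gap whose Hoelder cost is exactly \<open>l\<close>, half of the
    \<open>2 * l\<close> gained in time.\<close>
  define \<eta> where "\<eta> = (l / B) powr (1 / \<alpha>)"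
  have "\<eta> > 0" and \<eta>: "\<eta> powr \<alpha> * B = l"
    using \<open>l > 0\<close> \<open>B > 0\<close> \<open>0 < \<alpha>\<close> by (auto simp: \<eta>_def powr_powr)
  \<comment> \<open>The first entry limits the quadratic cost at \<open>(X0, X0)\<close> to
    \<open>\<sigma> / 4\<close>; the second keeps the gradient gap at the maximum below
    \<open>\<eta>\<close>.\<close>
  define \<nu> where "\<nu> = min (\<sigma> / (8 * ((norm X0)\<^sup>2 + 1))) (\<eta>\<^sup>2 / (32 * B))"
  have "\<nu> > 0"
    using \<open>0 < \<sigma>\<close> \<open>\<eta> > 0\<close> \<open>B > 0\<close> by (simp add: \<nu>_def add_nonneg_pos)
  have \<nu>_small: "2 * (\<nu> * (norm X0)\<^sup>2) \<le> \<sigma> / 4"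
  proof -
    have "\<nu> * (norm X0)\<^sup>2 \<le> \<sigma> / (8 * ((norm X0)\<^sup>2 + 1)) * ((norm X0)\<^sup>2 + 1)"
      using \<open>\<nu> > 0\<close> \<open>0 < \<sigma>\<close> by (intro mult_mono) (auto simp: \<nu>_def)
    also have "\<dots> = \<sigma> / 8"
      by (simp add: field_simps add_nonneg_eq_0_iff)
    finally show ?thesis by simp
  qed
  have \<nu>_\<eta>: "32 * B * \<nu> \<le> \<eta>\<^sup>2"
    using \<open>B > 0\<close> by (simp add: \<nu>_def min_def field_simps)
  \<comment> \<open>Chosen so that a coupling penalty below \<open>4 * B\<close> forces the points
    within \<open>\<delta>\<close>.\<close>
  define k where "k = 4 * B / \<delta>\<^sup>2"
  have "k > 0" using \<open>B > 0\<close> \<open>\<delta> > 0\<close> by (simp add: k_def)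

  define e :: "real \<times> real" where "e = (l, 0)"
  have e: "0 \<le> e \<bullet> X" if "X \<in> quadrant" for X
    using that \<open>l > 0\<close> by (auto simp: e_def quadrant_def)
  define \<Phi> where "\<Phi> X Y = m X - M Y - k * (norm (X - Y))\<^sup>2
      - \<nu> * (norm X)\<^sup>2 - \<nu> * (norm Y)\<^sup>2 - e \<bullet> X - e \<bullet> Y" for X Y
  have "e \<bullet> X0 = l * fst X0" by (simp add: e_def inner_prod_def)
  \<comment> \<open>On the diagonal the coupling term vanishes, and the remaining penalties use at
    most half of \<open>\<sigma>\<close>.\<close>
  then have \<Phi>0: "\<sigma> / 2 \<le> \<Phi> X0 X0"
    using l_small \<nu>_small by (simp add: \<Phi>_def \<sigma>_def)

  obtain XY where XY: "XY \<in> quadrant \<times> quadrant"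
    and XY_max: "\<And>P. P \<in> quadrant \<times> quadrant \<Longrightarrow> \<Phi> (fst P) (snd P) \<le> \<Phi> (fst XY) (snd XY)"
  proof (rule continuous_attains_max_of_quadratic_decay
      [where S = "quadrant \<times> quadrant" and f = "\<lambda>P. \<Phi> (fst P) (snd P)"
        and C = "2 * B" and \<nu> = \<nu> and ?x0.0 = "(X0, X0)"])
    have "continuous_on (quadrant \<times> quadrant) (\<lambda>P. m (fst P))"
      by (rule continuous_on_compose2[OF uniformly_continuous_imp_continuous[OF assms(4)]])
        (auto intro: continuous_on_fst continuous_on_snd)
    moreover have "continuous_on (quadrant \<times> quadrant) (\<lambda>P. M (snd P))"
      by (rule continuous_on_compose2[OF uniformly_continuous_imp_continuous[OF assms(6)]])
        (auto intro: continuous_on_fst continuous_on_snd)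
    ultimately show "continuous_on (quadrant \<times> quadrant) (\<lambda>P. \<Phi> (fst P) (snd P))"
      unfolding \<Phi>_def by (intro continuous_on_diff) (assumption | intro continuous_intros)+
  next
    fix P assume P: "P \<in> quadrant \<times> quadrant"
    have "m (fst P) - M (snd P) \<le> 2 * B" using P Bm[of "fst P"] BM[of "snd P"] by auto
    moreover have "(norm P)\<^sup>2 = (norm (fst P))\<^sup>2 + (norm (snd P))\<^sup>2"
      by (simp add: norm_prod_def)
    moreover have "0 \<le> e \<bullet> fst P" "0 \<le> e \<bullet> snd P" "0 \<le> k * (norm (fst P - snd P))\<^sup>2"
      using P e \<open>k > 0\<close> by auto
    ultimately show "\<Phi> (fst P) (snd P) \<le> 2 * B - \<nu> * (norm P)\<^sup>2"
      by (simp add: \<Phi>_def distrib_left)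
  qed (use X0 \<open>\<nu> > 0\<close> in \<open>auto intro: closed_Times closed_quadrant\<close>)
  define X Y where "X = fst XY" and "Y = snd XY"
  have X: "X \<in> quadrant" and Y: "Y \<in> quadrant" using XY by (auto simp: X_def Y_def)
  have max: "\<Phi> X' Y' \<le> \<Phi> X Y" if "X' \<in> quadrant" "Y' \<in> quadrant" for X' Y'
    using XY_max[of "(X', Y')"] that by (simp add: X_def Y_def)

  have \<Phi>XY: "\<sigma> / 2 \<le> \<Phi> X Y" using \<Phi>0 max[OF X0 X0] by simp
  have nonneg: "0 \<le> k * (norm (X - Y))\<^sup>2" "0 \<le> \<nu> * (norm X)\<^sup>2" "0 \<le> \<nu> * (norm Y)\<^sup>2"
      "0 \<le> e \<bullet> X" "0 \<le> e \<bullet> Y"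
    using \<open>k > 0\<close> \<open>\<nu> > 0\<close> e X Y by auto
  have diff: "\<sigma> / 2 \<le> m X - M Y" using \<Phi>XY nonneg by (simp add: \<Phi>_def)
  have "m X - M Y \<le> 2 * B" using Bm[OF X] BM[OF Y] by linarith
  \<comment> \<open>As \<open>\<Phi> X Y\<close> is positive, no single penalty exceeds
    \<open>2 * B\<close>; the strict bound gives strict closeness below.\<close>
  then have k_le: "k * (norm (X - Y))\<^sup>2 < 4 * B"
    and \<nu>_le: "\<nu> * (norm X)\<^sup>2 \<le> 2 * B" "\<nu> * (norm Y)\<^sup>2 \<le> 2 * B"
    using \<Phi>XY nonneg \<open>0 < \<sigma>\<close> \<open>B > 0\<close> by (auto simp: \<Phi>_def)
  have "(norm (X - Y))\<^sup>2 < \<delta>\<^sup>2"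
    using k_le \<open>B > 0\<close> \<open>\<delta> > 0\<close> by (simp add: k_def field_simps)
  then have near: "dist X Y < \<delta>"
    using \<open>\<delta> > 0\<close> by (auto simp: dist_norm intro: power_less_imp_less_base)

  have "\<not> (fst X = 0 \<or> snd X = 0)"
  proof
    assume "fst X = 0 \<or> snd X = 0"
    \<comment> \<open>The boundary data reduce \<open>m X - M Y\<close> to an oscillation of
      \<open>M\<close>, smaller than the gap.\<close>
    then have "m X \<le> M X" using sub_le_super_on_boundary assms(7,8) X by blast
    moreover have "\<bar>M X - M Y\<bar> < \<sigma> / 2" using d2[OF X Y] near by (simp add: \<delta>_def dist_real_def)
    ultimately show False using diff by linarith
  qed
  then have posX: "0 < fst X" "0 < snd X" using X by (auto simp: quadrant_def)
  have "\<not> (fst Y = 0 \<or> snd Y = 0)"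
  proof
    assume "fst Y = 0 \<or> snd Y = 0"
    \<comment> \<open>Symmetrically, only an oscillation of \<open>m\<close> remains.\<close>
    then have "m Y \<le> M Y" using sub_le_super_on_boundary assms(7,8) Y by blast
    moreover have "\<bar>m X - m Y\<bar> < \<sigma> / 2" using d1[OF X Y] near by (simp add: \<delta>_def dist_real_def)
    ultimately show False using diff by linarith
  qed
  then have posY: "0 < fst Y" "0 < snd Y" using Y by (auto simp: quadrant_def)

  \<comment> \<open>The coupling term is common to \<open>p\<close> and \<open>q\<close>, so their
    difference is free of \<open>k\<close>.\<close>
  define p where "p = (2 * k) *\<^sub>R (X - Y) + (2 * \<nu>) *\<^sub>R X + e"
  define q where "q = (2 * k) *\<^sub>R (X - Y) - (2 * \<nu>) *\<^sub>R Y - e"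
  have "p \<in> frechet_superdiff m X"
    unfolding p_def
  proof (rule doubled_max_superdiff)
    fix Z assume "Z \<in> quadrant"
    from max[OF this Y] show "m Z - k * (norm (Z - Y))\<^sup>2 - \<nu> * (norm Z)\<^sup>2 - e \<bullet> Z
        \<le> m X - k * (norm (X - Y))\<^sup>2 - \<nu> * (norm X)\<^sup>2 - e \<bullet> X"
      by (simp add: \<Phi>_def)
  qed
  then have sub: "fst p + max (snd p) 0 powr \<alpha> * m X \<le> 0"
    by (rule viscosity_subsolutionD[OF assms(7) posX])
  have "q \<in> frechet_subdiff M Y"
    unfolding q_def
  proof (rule doubled_max_subdiff)
    fix Z assume "Z \<in> quadrant"
    from max[OF X this] show "- M Z - k * (norm (X - Z))\<^sup>2 - \<nu> * (norm Z)\<^sup>2 - e \<bullet> Z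
        \<le> - M Y - k * (norm (X - Y))\<^sup>2 - \<nu> * (norm Y)\<^sup>2 - e \<bullet> Y"
      by (simp add: \<Phi>_def)
  qed
  then have super: "0 \<le> fst q + max (snd q) 0 powr \<alpha> * M Y"
    by (rule viscosity_supersolutionD[OF assms(8) posY])

  \<comment> \<open>Although the maximum may be far out, \<open>\<nu> * norm Z\<close> is of order
    sqrt \<nu>; each point contributes at most half of \<open>\<eta>\<close>.\<close>
  have \<nu>_norm: "2 * \<nu> * norm Z \<le> \<eta> / 2" if "\<nu> * (norm Z)\<^sup>2 \<le> 2 * B" for Z :: "real \<times> real"
  proof -
    have "(4 * \<nu> * norm Z)\<^sup>2 = 16 * \<nu> * (\<nu> * (norm Z)\<^sup>2)" by (simp add: power2_eq_square)
    also have "\<dots> \<le> 16 * \<nu> * (2 * B)" using that \<open>\<nu> > 0\<close> by (intro mult_left_mono) auto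
    also have "\<dots> \<le> \<eta>\<^sup>2" using \<nu>_\<eta> by (simp add: mult_ac)
    finally have "4 * \<nu> * norm Z \<le> \<eta>" using \<open>\<eta> > 0\<close> by (auto intro: power2_le_imp_le)
    then show ?thesis by simp
  qed
  have pq: "snd p - snd q = 2 * \<nu> * (snd X + snd Y)"
    by (simp add: p_def q_def e_def algebra_simps)
  have pq_nonneg: "0 \<le> snd p - snd q" using pq \<open>\<nu> > 0\<close> posX posY by simp
  have "snd X \<le> norm X" "snd Y \<le> norm Y"
    using norm_snd_le[of "snd X" "fst X"] norm_snd_le[of "snd Y" "fst Y"] by auto
  then have "snd p - snd q \<le> 2 * \<nu> * (norm X + norm Y)"
    unfolding pq using \<open>\<nu> > 0\<close> by (intro mult_left_mono) auto
  also have "\<dots> \<le> \<eta>" using \<nu>_norm[OF \<nu>_le(1)] \<nu>_norm[OF \<nu>_le(2)] by (simp add: distrib_left)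
  finally have "(snd p - snd q) powr \<alpha> \<le> \<eta> powr \<alpha>"
    using pq_nonneg \<open>0 < \<alpha>\<close> by (intro powr_mono2) auto
  then have "(snd p - snd q) powr \<alpha> * B \<le> \<eta> powr \<alpha> * B"
    using \<open>B > 0\<close> by (intro mult_right_mono) auto
  then have "(snd p - snd q) powr \<alpha> * B \<le> l" unfolding \<eta> .
  \<comment> \<open>The gradients of the two time penalties add up to \<open>2 * l\<close>, which
    exceeds the Hoelder cost \<open>l\<close>.\<close>
  moreover have "fst p - fst q = 2 * l + 2 * \<nu> * (fst X + fst Y)"
    by (simp add: p_def q_def e_def algebra_simps)
  then have "2 * l \<le> fst p - fst q" using \<open>\<nu> > 0\<close> posX posY by simp
  ultimately show False
    using viscosity_inequalities_incompatible[OF sub super, of B l] assms(1,2) Bm[OF X] diff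
      pq_nonneg \<open>0 < \<sigma>\<close> \<open>l > 0\<close> by simp
qed

end
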